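(* Let $n$ be odd, $q=2^n$, let $L(X)=\sum_{i=0}^{n-1}a_iX^{2^i}\in\mathbb{F}_q[X]$ be a linearized polynomial with adjoint $\bar{L}(X)=\sum_{i=0}^{n-1}a_i^{2^{n-i}}X^{2^{n-i}}$, and let $\alpha\in\mathbb{F}_q^*$. Then $\{(L(y),y): y\in\mathbb{F}_q\}\cup\{(0),(\alpha)\}$ is a hyperoval in $\Pi(\mathbb{K}_n)$ if and only if the set of lines $$\mathcal{L}_c=\{l_{\bar{L}(m),m}: m\in\mathbb{F}_q\}\cup\{l_0,l_\alpha\}$$ is a line hyperoval in $\Pi(\mathbb{K}_n^{td})$, where $l_{\bar L(m),m}=\{(x,y): y=x\circ\bar{L}(m)+m\}\cup\{(\bar L(m))\}$.
   Context: $\mathrm{Tr}:\mathbb{F}_q\to\mathbb{F}_2$ is the absolute trace. Knuth's presemifield $\mathbb{K}_n=(\mathbb{F}_q,+,* )$ ($n$ odd) has $x*y=xy+(y\,\mathrm{Tr}(x)+x\,\mathrm{Tr}(y))^2$; the presemifield $\mathbb{K}_n^{td}=(\mathbb{F}_q,+,\circ)$ has $x\circ y=xy+\mathrm{Tr}(x)\,y^{2^{n-1}}+\mathrm{Tr}(x^2y)$. For a presemifield $(\mathbb{F}_q,+,\star)$, the plane $\Pi$ has affine points $(a,b)$, points at infinity $(a)$, $a\in\mathbb{F}_q\cup\{\infty\}$, and lines: $l_\infty$ (the line at infinity); $l_a=\{(a,y):y\in\mathbb{F}_q\}\cup\{(\infty)\}$ for $a\in\mathbb{F}_q$; $l_{a,b}=\{(x,y):y=x\star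 a+b\}\cup\{(a)\}$ for $a,b\in\mathbb{F}_q$. A hyperoval is a set of $q+2$ points no three collinear; a line hyperoval is a set of $q+2$ lines no three concurrent. *)

theory Defs
  imports "HOL-Computational_Algebra.Polynomial" "HOL-Library.Cardinality"
begin

text \<open>
  The field $F_q$ is an arbitrary type of class \<open>{field, finite}\<close>; that it has order
  $2^n$ is a hypothesis \<open>CARD('a) = 2 ^ n\<close>. The absolute trace is regarded as
  taking its values in the prime subfield $\{0,1\}$ of $F_q$, so that it can be multiplied with
  field elements.
\<close>

definition abs_trace :: "nat \<Rightarrow> 'a::field \<Rightarrow> 'a" where
  "abs_trace n x = (\<Sum>i<n. x ^ (2 ^ i))"

definition knuth_mult :: "nat \<Rightarrow> 'a::field \<Rightarrow> 'a \<Rightarrow> 'a" where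
  "knuth_mult n x y = x * y + (y * abs_trace n x + x * abs_trace n y)\<^sup>2"

definition knuth_td_mult :: "nat \<Rightarrow> 'a::field \<Rightarrow> 'a \<Rightarrow> 'a" where
  "knuth_td_mult n x y =
     x * y + abs_trace n x * y ^ (2 ^ (n - 1)) + abs_trace n (x\<^sup>2 * y)"

text \<open>
  The plane of a presemifield with multiplication \<open>star\<close>. \<open>Slope a\<close> is the point at infinity
  $(a)$ and \<open>Infty\<close> the point $(\infty)$; lines are identified with their sets of points.
  The definitions make sense for every binary operation \<open>star\<close>; they give a projective plane
  when \<open>star\<close> is a presemifield multiplication.
\<close>

datatype 'a point = Affine 'a 'a | Slope 'a | Infty

definition line_at_infinity :: "'a point set" where
  "line_at_infinity = range Slope \<union> {Infty}"

definition vertical_line :: "'a \<Rightarrow> 'a point set" where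
  "vertical_line a = {Affine a y | y. True} \<union> {Infty}"

definition sloped_line ::
    "('a::field \<Rightarrow> 'a \<Rightarrow> 'a) \<Rightarrow> 'a \<Rightarrow> 'a \<Rightarrow> 'a point set" where
  "sloped_line star a b = {Affine x y | x y. y = star x a + b} \<union> {Slope a}"

definition plane_lines :: "('a::field \<Rightarrow> 'a \<Rightarrow> 'a) \<Rightarrow> 'a point set set" where
  "plane_lines star =
     {line_at_infinity} \<union> range vertical_line \<union> {sloped_line star a b | a b. True}"

definition hyperoval ::
    "('a::{field,finite} \<Rightarrow> 'a \<Rightarrow> 'a) \<Rightarrow> 'a point set \<Rightarrow> bool" where
  "hyperoval star H \<longleftrightarrow>
     card H = CARD('a) + 2 \<and>
     (\<forall>T \<subseteq> H. card T = 3 \<longrightarrow> \<not> (\<exists>l \<in> plane_lines star. T \<subseteq> l))"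

definition line_hyperoval ::
    "('a::{field,finite} \<Rightarrow> 'a \<Rightarrow> 'a) \<Rightarrow> 'a point set set \<Rightarrow> bool" where
  "line_hyperoval star \<L> \<longleftrightarrow>
     \<L> \<subseteq> plane_lines star \<and> card \<L> = CARD('a) + 2 \<and>
     (\<forall>T \<subseteq> \<L>. card T = 3 \<longrightarrow> \<not> (\<exists>P. \<forall>l \<in> T. P \<in> l))"

definition linearized_poly :: "nat \<Rightarrow> (nat \<Rightarrow> 'a::field) \<Rightarrow> 'a poly" where
  "linearized_poly n a = (\<Sum>i<n. monom (a i) (2 ^ i))"

definition adjoint_poly :: "nat \<Rightarrow> (nat \<Rightarrow> 'a::field) \<Rightarrow> 'a poly" where
  "adjoint_poly n a = (\<Sum>i<n. monom (a i ^ (2 ^ (n - i))) (2 ^ (n - i)))"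

end

theory Submission
  imports Defs
begin

text \<open>
  Each incidence condition says that all fibres of some additive map of the field are small, which
  is a condition on the size of its kernel. The trace form is nondegenerate, so adjoint additive maps
  have kernels of the same size. The adjoint of $x \mapsto x * u$ is $z \mapsto u \circ z$, so
  $y + L(y) * u$ has adjoint $z + \bar L(u \circ z)$, and the kernel of the latter is as large as
  that of $m + u \circ \bar L(m)$, since $1 + AB$ and $1 + BA$ always have kernels of equal size.
\<close>

section \<open>Hyperovals as bounds on incidence counts\<close>

text \<open>Trades quantification over triples for a count. With \<open>P\<close> as "lies on a
  given line" or "passes through a given point" it serves hyperovals and line hyperovals
  alike.\<close>

lemma triple_free_iff_card_le_two:
  assumes "finite H"
  shows "(\<forall>T\<subseteq>H. card T = 3 \<longrightarrow> \<not> (\<forall>x\<in>T. P x)) \<longleftrightarrow> card {x \<in> H. P x} \<le> 2"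
proof
  assume no_triple: "\<forall>T\<subseteq>H. card T = 3 \<longrightarrow> \<not> (\<forall>x\<in>T. P x)"
  show "card {x \<in> H. P x} \<le> 2"
  proof (rule ccontr)
    assume "\<not> card {x \<in> H. P x} \<le> 2"
    then obtain T where "T \<subseteq> {x \<in> H. P x}" "card T = 3"
      by (metis obtain_subset_with_card_n not_less_eq_eq numeral_3_eq_3 numeral_2_eq_2)
    with no_triple show False
      by (metis (no_types, lifting) mem_Collect_eq subset_iff)
  qed
next
  assume le: "card {x \<in> H. P x} \<le> 2"
  show "\<forall>T\<subseteq>H. card T = 3 \<longrightarrow> \<not> (\<forall>x\<in>T. P x)"
  proof (intro allI impI notI)
    fix T assume "T \<subseteq> H" "card T = 3" "\<forall>x\<in>T. P x"
    then have "card T \<le> card {x \<in> H. P x}"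
      by (intro card_mono) (use assms in auto)
    with le \<open>card T = 3\<close> show False by simp
  qed
qed

text \<open>Counts incidences in both planes: \<open>f\<close> parametrizes the members that come
  from the field, and \<open>z\<close> is the one possible extra member, a point at infinity or a
  vertical line.\<close>

lemma card_image_Un_if:
  fixes f :: "'a::finite \<Rightarrow> 'b"
  assumes "inj_on f A" "\<And>x. f x \<noteq> z"
  shows "card (f ` A \<union> (if c then {z} else {})) = card A + of_bool c"
proof -
  have "z \<notin> f ` A" using assms(2) by blast
  then show ?thesis by (simp add: card_image[OF assms(1)])
qed

lemma hyperoval_iff_card_le_two:
  fixes star :: "'a::{field,finite} \<Rightarrow> 'a \<Rightarrow> 'a"
  assumes "card H = CARD('a) + 2"
  shows "hyperoval star H \<longleftrightarrow> (\<forall>l\<in>plane_lines star. card {p \<in> H. p \<in> l} \<le> 2)"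
proof -
  have "finite H" using assms by (intro card_ge_0_finite) simp
  have "hyperoval star H \<longleftrightarrow>
      (\<forall>l\<in>plane_lines star. \<forall>T\<subseteq>H. card T = 3 \<longrightarrow> \<not> (\<forall>p\<in>T. p \<in> l))"
    unfolding hyperoval_def subset_eq[of _ "_ :: 'a point set"] using assms by blast
  then show ?thesis
    by (simp only: triple_free_iff_card_le_two[OF \<open>finite H\<close>])
qed

lemma line_hyperoval_iff_card_le_two:
  fixes star :: "'a::{field,finite} \<Rightarrow> 'a \<Rightarrow> 'a"
  assumes "card \<L> = CARD('a) + 2" "\<L> \<subseteq> plane_lines star"
  shows "line_hyperoval star \<L> \<longleftrightarrow> (\<forall>P. card {l \<in> \<L>. P \<in> l} \<le> 2)"
proof -
  have "finite \<L>" using assms(1) by (intro card_ge_0_finite) simp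
  have "line_hyperoval star \<L> \<longleftrightarrow>
      (\<forall>P. \<forall>T\<subseteq>\<L>. card T = 3 \<longrightarrow> \<not> (\<forall>l\<in>T. P \<in> l))"
    unfolding line_hyperoval_def using assms by blast
  then show ?thesis
    by (simp only: triple_free_iff_card_le_two[OF \<open>finite \<L>\<close>])
qed

lemma ball_plane_lines:
  "(\<forall>l\<in>plane_lines star. Q l) \<longleftrightarrow>
    Q line_at_infinity \<and> (\<forall>c. Q (vertical_line c)) \<and> (\<forall>u b. Q (sloped_line star u b))"
  by (auto simp: plane_lines_def)

lemma all_point:
  "(\<forall>P. Q P) \<longleftrightarrow> (\<forall>x y. Q (Affine x y)) \<and> (\<forall>u. Q (Slope u)) \<and> Q Infty"
  by (metis point.exhaust)

section \<open>Fibres and kernels of additive maps\<close>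

text \<open>Subtracting one element of a nonempty fibre moves that fibre injectively into the
  kernel. This removes the intercepts and constants from the incidence conditions.\<close>

lemma card_additive_fibres_le_iff:
  fixes f :: "'a::{ab_group_add,finite} \<Rightarrow> 'b::ab_group_add"
  assumes "additive f"
  shows "(\<forall>b. card {y. f y = b} \<le> k) \<longleftrightarrow> card {y. f y = 0} \<le> k"
proof (intro iffI allI)
  fix b assume le: "card {y. f y = 0} \<le> k"
  show "card {y. f y = b} \<le> k"
  proof (cases "\<exists>c. f c = b")
    case True
    then obtain c where "f c = b" by blast
    then have "card {y. f y = b} \<le> card {y. f y = 0}"
      by (intro card_inj_on_le[of "\<lambda>y. y - c"]) (auto simp: inj_on_def additive.diff[OF assms])
    with le show ?thesis by simp
  next
    case False
    then have "{y. f y = b} = {}" by blast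
    then show ?thesis by simp
  qed
qed blast

text \<open>\<open>B\<close> carries the first kernel into the second. It is injective there because
  \<open>z + A (B z) = 0\<close> determines \<open>z\<close> from \<open>B z\<close>.\<close>

lemma card_kernel_one_plus_comp_le:
  fixes A :: "'a::{ab_group_add,finite} \<Rightarrow> 'b::{ab_group_add,finite}" and B :: "'b \<Rightarrow> 'a"
  assumes "additive A" "additive B"
  shows "card {z. z + A (B z) = 0} \<le> card {m. m + B (A m) = 0}"
proof (rule card_inj_on_le[of B])
  show "inj_on B {z. z + A (B z) = 0}"
  proof (rule inj_onI)
    fix z z' assume "z \<in> {z. z + A (B z) = 0}" "z' \<in> {z. z + A (B z) = 0}" "B z = B z'"
    then have "z + A (B z) = z' + A (B z)" by simp
    then show "z = z'" by simp
  qed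
  show "B ` {z. z + A (B z) = 0} \<subseteq> {m. m + B (A m) = 0}"
    by (auto simp: additive.zero[OF assms(2)] simp flip: additive.add[OF assms(2)])
qed simp

lemma card_kernel_one_plus_comp:
  fixes A :: "'a::{ab_group_add,finite} \<Rightarrow> 'b::{ab_group_add,finite}" and B :: "'b \<Rightarrow> 'a"
  assumes "additive A" "additive B"
  shows "card {z. z + A (B z) = 0} = card {m. m + B (A m) = 0}"
  by (intro le_antisym card_kernel_one_plus_comp_le assms)

section \<open>Frobenius and the absolute trace in characteristic two\<close>

text \<open>Multiplication by a nonzero \<open>x\<close> permutes the nonzero elements, so their
  product, itself nonzero, absorbs the factor \<open>x ^ (q - 1)\<close>.\<close>

lemma finite_field_power_card:
  fixes x :: "'a::{field,finite}"
  shows "x ^ CARD('a) = x"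
proof (cases "x = 0")
  case False
  let ?U = "UNIV - {0::'a}"
  have "prod (\<lambda>y. x * y) ?U = \<Prod>?U"
    by (rule prod.reindex_bij_witness[of _ "\<lambda>y. y / x" "\<lambda>y. x * y"]) (use False in auto)
  then have "x ^ card ?U * \<Prod>?U = \<Prod>?U"
    by (simp add: prod.distrib)
  moreover have "\<Prod>?U \<noteq> 0"
    by (simp add: prod_zero_iff)
  ultimately have "x ^ card ?U = 1"
    by simp
  moreover have "CARD('a) = Suc (card ?U)"
    using card.remove[of UNIV "0::'a"] by simp
  ultimately show ?thesis
    by (simp only: power_Suc mult_1_right)
qed simp

context
  fixes n :: nat
  assumes card_field: "CARD('a::{field,finite}) = 2 ^ n"
begin

lemma n_pos: "n > 0"
proof (rule ccontr)
  assume "\<not> n > 0"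
  then have "CARD('a) = 1" using card_field by simp
  then obtain c where "(UNIV :: 'a set) = {c}" by (auto simp: card_1_singleton_iff)
  then have "(0::'a) = 1" by (metis UNIV_I singletonD)
  then show False by simp
qed

lemma power_q: "x ^ (2 ^ n) = (x::'a)"
  using finite_field_power_card[of x] card_field by simp

lemma add_self: "x + x = (0::'a)"
proof -
  \<comment> \<open>The exponent q is even since n is positive, so the q-th power of -1 is 1; it is
    also -1 because q-th powers are trivial.\<close>
  have "(- 1 :: 'a) = 1"
    using power_q[of "- 1"] n_pos by (simp add: power_minus_even[of "2 ^ n"] uminus_power_if)
  then have "(1::'a) + 1 = 0" by (metis add.right_inverse)
  then show ?thesis by (metis distrib_left mult.right_neutral mult_zero_right)
qed

lemma square_add: "(x + y)\<^sup>2 = x\<^sup>2 + (y\<^sup>2 :: 'a)"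
  using add_self[of "x * y"] by (simp add: power2_eq_square algebra_simps)

lemma frobenius_add: "(x + y) ^ (2 ^ i) = x ^ (2 ^ i) + (y ^ (2 ^ i) :: 'a)"
  by (induction i arbitrary: x y) (simp_all add: power_mult square_add)

lemma additive_frobenius: "additive (\<lambda>x::'a. x ^ (2 ^ i))"
  by standard (rule frobenius_add)

lemma trace_additive: "additive (abs_trace n :: 'a \<Rightarrow> 'a)"
  by standard (simp add: abs_trace_def frobenius_add sum.distrib)

lemmas trace_add = additive.add[OF trace_additive]

lemma square_sum: "(\<Sum>i\<in>I. f i)\<^sup>2 = (\<Sum>i\<in>I. (f i :: 'a)\<^sup>2)"
  using additive.sum[OF additive_frobenius[of 1]] by simp

text \<open>Adding \<open>x\<close> completes either trace to the sum of \<open>x ^ (2 ^ i)\<close>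
  over i from 0 to n: the left side lacks the term i = 0, the right side the term i = n, and both
  terms equal \<open>x\<close>.\<close>

lemma trace_square: "abs_trace n (x\<^sup>2) = abs_trace n (x::'a)"
proof -
  have "abs_trace n (x\<^sup>2) + x = (\<Sum>i<n. x ^ (2 ^ Suc i)) + x ^ (2 ^ 0)"
    by (simp add: abs_trace_def power_mult)
  also have "\<dots> = (\<Sum>i<Suc n. x ^ (2 ^ i))"
    by (subst sum.lessThan_Suc_shift) (simp add: add.commute)
  also have "\<dots> = abs_trace n x + x"
    by (simp add: abs_trace_def power_q)
  finally show ?thesis by simp
qed

lemma trace_power: "abs_trace n (x ^ (2 ^ i)) = abs_trace n (x::'a)"
  by (induction i arbitrary: x) (simp_all add: power_mult trace_square)

text \<open>Squaring the trace gives the trace of the square, so every trace is a root of T^2 -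
  T.\<close>

lemma trace_cases: "abs_trace n (x::'a) = 0 \<or> abs_trace n x = 1"
proof -
  have "(abs_trace n x)\<^sup>2 = abs_trace n (x\<^sup>2)"
    by (simp add: abs_trace_def square_sum mult.commute flip: power_mult)
  then have "abs_trace n x * (abs_trace n x - 1) = 0"
    by (simp add: trace_square power2_eq_square[of "abs_trace n x"] algebra_simps)
  then show ?thesis by simp
qed

text \<open>Otherwise the trace polynomial would have q roots although its degree is at most q/2. It
  is nonzero, since its coefficient at X comes from i = 0 alone.\<close>

lemma trace_onto: "\<exists>t::'a. abs_trace n t = 1"
proof (rule ccontr)
  assume "\<not> ?thesis"
  then have zero: "abs_trace n t = 0" for t :: 'a
    using trace_cases by blast
  define p :: "'a poly" where "p = (\<Sum>i<n. monom 1 (2 ^ i))"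
  have "poly p t = 0" for t
    using zero[of t] by (simp add: p_def poly_sum poly_monom abs_trace_def)
  moreover have "coeff p 1 = 1"
  proof -
    have "coeff p 1 = (\<Sum>i<n. if i = 0 then 1 else 0)"
      by (simp add: p_def coeff_sum)
    then show ?thesis using n_pos by simp
  qed
  then have "p \<noteq> 0" by auto
  ultimately have "CARD('a) \<le> degree p"
    using card_poly_roots_bound[of p] by simp
  also have "degree p \<le> 2 ^ (n - 1)"
    unfolding p_def by (intro degree_sum_le) (auto simp: degree_monom_eq)
  also have "\<dots> < 2 ^ n" using n_pos by simp
  finally show False using card_field by simp
qed

section \<open>The trace character and adjoint kernels\<close>

text \<open>The additive character (-1)^Tr(x). Its values are integers, not field elements, so that
  its sums can count in characteristic zero.\<close>

definition trace_char :: "'a \<Rightarrow> int" where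
  "trace_char x = (if abs_trace n x = 0 then 1 else - 1)"

lemma trace_char_add: "trace_char (x + y) = trace_char x * trace_char y"
proof -
  have "abs_trace n (x + y) = 0 \<longleftrightarrow> abs_trace n x = abs_trace n y"
    by (metis add_self trace_add add_right_cancel)
  then show ?thesis
    using trace_cases[of x] trace_cases[of y] by (auto simp: trace_char_def)
qed

text \<open>Orthogonality: for nonzero \<open>c\<close>, shifting \<open>y\<close> by
  \<open>t / c\<close> with \<open>t\<close> of trace 1 flips the sign of every term, so the sum is
  its own negative.\<close>

lemma sum_trace_char: "(\<Sum>y\<in>UNIV. trace_char (c * y)) = (if c = 0 then 2 ^ n else 0)"
proof (cases "c = 0")
  case True
  have "trace_char 0 = 1"
    by (simp add: trace_char_def additive.zero[OF trace_additive])
  then show ?thesis using True card_field by simp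
next
  case False
  obtain t :: 'a where t: "abs_trace n t = 1" using trace_onto by blast
  let ?S = "\<Sum>y\<in>UNIV. trace_char (c * y)"
  have "?S = (\<Sum>y\<in>UNIV. trace_char (c * (y + t / c)))"
    by (rule sum.reindex_bij_witness[of _ "\<lambda>y. y + t / c" "\<lambda>y. y - t / c"]) auto
  also have "\<dots> = (\<Sum>y\<in>UNIV. - trace_char (c * y))"
    using False t by (simp add: distrib_left trace_char_add) (simp add: trace_char_def)
  finally show ?thesis using False by (simp add: sum_negf)
qed

text \<open>
  The double sum of $(-1)^{\mathrm{Tr}(f(x) y)}$ over all $x$ and $y$ is $q$ times the size of either
  kernel, depending on which variable is summed first.
\<close>

lemma card_kernel_adjoint:
  fixes f g :: "'a \<Rightarrow> 'a"
  assumes adj: "\<And>x y. abs_trace n (f x * y) = abs_trace n (x * g y)"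
  shows "card {x. f x = 0} = card {y. g y = 0}"
proof -
  have "trace_char (f x * y) = trace_char (g y * x)" for x y
    using adj[of x y] by (simp add: trace_char_def mult.commute)
  then have "(\<Sum>x\<in>UNIV. \<Sum>y\<in>UNIV. trace_char (f x * y))
           = (\<Sum>y\<in>UNIV. \<Sum>x\<in>UNIV. trace_char (g y * x))"
    by (subst sum.swap) simp
  then have "int (card {x. f x = 0}) * 2 ^ n = int (card {y. g y = 0}) * 2 ^ n"
    by (simp add: sum_trace_char sum.If_cases)
  then show ?thesis by simp
qed

section \<open>Trace adjoints of linearized polynomials and Knuth's product\<close>

lemma additive_linearized: "additive (\<lambda>y::'a. poly (linearized_poly n a) y)"
  by standard
    (simp add: linearized_poly_def poly_sum poly_monom frobenius_add distrib_left sum.distrib)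

lemma additive_adjoint: "additive (\<lambda>y::'a. poly (adjoint_poly n a) y)"
  by standard
    (simp add: adjoint_poly_def poly_sum poly_monom frobenius_add distrib_left sum.distrib)

text \<open>The trace is invariant under Frobenius. Raising the i-th term to the power 2^(n-i) turns
  \<open>y ^ (2 ^ i)\<close> into \<open>y\<close> and leaves the i-th term of the adjoint; for i =
  0 this power is the identity on the field.\<close>

lemma trace_linearized_adjoint:
  "abs_trace n (poly (linearized_poly n a) y * z) = abs_trace n (y * poly (adjoint_poly n a) (z::'a))"
proof -
  have "abs_trace n (a i * y ^ (2 ^ i) * z)
      = abs_trace n (y * (a i ^ (2 ^ (n - i)) * z ^ (2 ^ (n - i))))" if "i < n" for i
  proof -
    have "(y ^ (2 ^ i)) ^ (2 ^ (n - i)) = y"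
      using that power_q[of y] by (simp flip: power_mult power_add)
    then show ?thesis
      by (subst trace_power[of _ "n - i", symmetric]) (simp add: power_mult_distrib mult_ac)
  qed
  then show ?thesis
    by (simp add: linearized_poly_def adjoint_poly_def poly_sum poly_monom sum_distrib_left
        sum_distrib_right additive.sum[OF trace_additive])
qed

lemma additive_knuth_left: "additive (\<lambda>x::'a. knuth_mult n x u)"
proof
  fix x y :: 'a
  have "u * abs_trace n (x + y) + (x + y) * abs_trace n u
      = (u * abs_trace n x + x * abs_trace n u) + (u * abs_trace n y + y * abs_trace n u)"
    by (simp add: trace_add algebra_simps)
  then show "knuth_mult n (x + y) u = knuth_mult n x u + knuth_mult n y u"
    by (simp only: knuth_mult_def square_add distrib_right add_ac)
qed

lemma additive_knuth_td_right: "additive (\<lambda>z::'a. knuth_td_mult n u z)"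
  by standard (simp add: knuth_td_mult_def trace_add frobenius_add algebra_simps)

text \<open>Linearity over the prime field: the scalar is itself a trace, hence 0 or 1.\<close>

lemma trace_scale: "abs_trace n (abs_trace n u * x) = abs_trace n u * abs_trace n (x::'a)"
  using trace_cases[of u] additive.zero[OF trace_additive] by auto

text \<open>After expansion the scalar traces can be pulled out, and both sides become Tr(xuz) +
  Tr(x) Tr(u^2 z) + Tr(u) Tr(x^2 z).\<close>

lemma trace_knuth_adjoint:
  "abs_trace n (knuth_mult n x u * z) = abs_trace n (x * knuth_td_mult n u (z::'a))"
proof -
  \<comment> \<open>The power of \<open>z\<close> is its square root, so squaring inside the trace
    removes it and turns \<open>x\<close> into its square.\<close>
  have root: "abs_trace n (x * z ^ 2 ^ (n - 1)) = abs_trace n (x\<^sup>2 * z)"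
  proof -
    have "(z ^ 2 ^ (n - 1))\<^sup>2 = z"
      using power_q[of z] n_pos by (simp flip: power_mult power_Suc2)
    then show ?thesis
      using trace_square[of "x * z ^ 2 ^ (n - 1)"] by (simp add: power_mult_distrib)
  qed
  have idem: "(abs_trace n v)\<^sup>2 = (abs_trace n v :: 'a)" for v
    using trace_cases[of v] by auto
  have "knuth_mult n x u * z
      = x * u * z + (abs_trace n x * (u\<^sup>2 * z) + abs_trace n u * (x\<^sup>2 * z))"
    by (simp add: knuth_mult_def square_add power_mult_distrib idem
        algebra_simps)
  moreover have "x * knuth_td_mult n u z
      = x * u * z + (abs_trace n (u\<^sup>2 * z) * x + abs_trace n u * (x * z ^ 2 ^ (n - 1)))"
    by (simp add: knuth_td_mult_def algebra_simps)
  ultimately show ?thesis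
    by (simp add: trace_add trace_scale root del: One_nat_def)
qed

lemma card_kernel_knuth:
  fixes a :: "nat \<Rightarrow> 'a"
  defines "L \<equiv> poly (linearized_poly n a)" and "M \<equiv> poly (adjoint_poly n a)"
  shows "card {y. y + knuth_mult n (L y) u = 0} = card {m. m + knuth_td_mult n u (M m) = 0}"
proof -
  have "abs_trace n ((y + knuth_mult n (L y) u) * z)
      = abs_trace n (y * (z + M (knuth_td_mult n u z)))" for y z
    by (simp add: L_def M_def distrib_left distrib_right trace_add trace_knuth_adjoint
        trace_linearized_adjoint)
  then have "card {y. y + knuth_mult n (L y) u = 0}
           = card {z. z + M (knuth_td_mult n u z) = 0}"
    by (rule card_kernel_adjoint)
  \<comment> \<open>Exchanging the order of \<open>M\<close> and multiplication by \<open>u\<close>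
    gives the form that appears when lines through an affine point with first coordinate
    \<open>u\<close> are counted.\<close>
  also have "\<dots> = card {m. m + knuth_td_mult n u (M m) = 0}"
    unfolding M_def by (rule card_kernel_one_plus_comp[OF additive_adjoint additive_knuth_td_right])
  finally show ?thesis .
qed

section \<open>Incidence counts in the two planes\<close>

text \<open>Signs vanish in characteristic two; this turns the equation of a sloped line into
  membership in a fibre of an additive map.\<close>

lemma add_eq_iff: "y = x + b \<longleftrightarrow> y + x = (b::'a)"
proof -
  have cancel: "x + (x + c) = c" for c
    by (simp add: add_self flip: add.assoc)
  show ?thesis
    using cancel[of b] cancel[of y] by (auto simp: add.commute)
qed

text \<open>Lines are sorted by type. The line at infinity holds just the two given slopes. A
  vertical line cuts out a fibre of \<open>L\<close>, and a line of slope \<open>u\<close> a fibre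
  of \<open>y + star (L y) u\<close>, together with the point \<open>Slope u\<close> if that was
  added.\<close>

lemma hyperoval_graph_iff:
  fixes L :: "'a \<Rightarrow> 'a" and star :: "'a \<Rightarrow> 'a \<Rightarrow> 'a"
  assumes L: "additive L" and star: "\<And>u. additive (\<lambda>x. star x u)" and "\<alpha> \<noteq> 0"
  shows "hyperoval star ({Affine (L y) y | y. True} \<union> {Slope 0, Slope \<alpha>}) \<longleftrightarrow>
    card {y. L y = 0} \<le> 2 \<and>
    (\<forall>u. card {y. y + star (L y) u = 0} + of_bool (u \<in> {0, \<alpha>}) \<le> 2)"
proof -
  let ?P = "\<lambda>y. Affine (L y) y"
  let ?H = "{?P y | y. True} \<union> {Slope 0, Slope \<alpha>}"
  have inj: "inj_on ?P A" for A by (auto simp: inj_on_def)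
  have H: "?H = range ?P \<union> {Slope 0, Slope \<alpha>}" by blast
  have "card ?H = CARD('a) + 2"
    unfolding H using \<open>\<alpha> \<noteq> 0\<close> by (subst card_Un_disjoint) (auto simp: card_image[OF inj])
  then have "hyperoval star ?H \<longleftrightarrow> (\<forall>l\<in>plane_lines star. card {p \<in> ?H. p \<in> l} \<le> 2)"
    by (rule hyperoval_iff_card_le_two)
  also have "\<dots> \<longleftrightarrow> (\<forall>c. card {p \<in> ?H. p \<in> vertical_line c} \<le> 2) \<and>
      (\<forall>u b. card {p \<in> ?H. p \<in> sloped_line star u b} \<le> 2)"
  proof -
    have "{p \<in> ?H. p \<in> line_at_infinity} = {Slope 0, Slope \<alpha>}"
      by (auto simp: line_at_infinity_def)
    then have "card {p \<in> ?H. p \<in> line_at_infinity} \<le> 2"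
      by (simp only:) (simp add: card_insert_if)
    then show ?thesis
      unfolding ball_plane_lines by blast
  qed
  also have "(\<forall>c. card {p \<in> ?H. p \<in> vertical_line c} \<le> 2) \<longleftrightarrow> card {y. L y = 0} \<le> 2"
  proof -
    have "{p \<in> ?H. p \<in> vertical_line c} = ?P ` {y. L y = c}" for c
      by (auto simp: vertical_line_def)
    then show ?thesis
      by (simp only: card_image[OF inj] card_additive_fibres_le_iff[OF L])
  qed
  also have "(\<forall>u b. card {p \<in> ?H. p \<in> sloped_line star u b} \<le> 2) \<longleftrightarrow>
      (\<forall>u. card {y. y + star (L y) u = 0} + of_bool (u \<in> {0, \<alpha>}) \<le> 2)"
  proof (rule all_cong1)
    fix u
    have "{p \<in> ?H. p \<in> sloped_line star u b}
        = ?P ` {y. y + star (L y) u = b} \<union> (if u \<in> {0, \<alpha>} then {Slope u} else {})" for b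
      by (auto simp: sloped_line_def add_eq_iff)
    then have "card {p \<in> ?H. p \<in> sloped_line star u b}
        = card {y. y + star (L y) u = b} + of_bool (u \<in> {0, \<alpha>})" for b
      by (simp only:) (rule card_image_Un_if[OF inj], simp)
    \<comment> \<open>Truncated subtraction is harmless here, as the extra incidence is at most
      1.\<close>
    then have "(\<forall>b. card {p \<in> ?H. p \<in> sloped_line star u b} \<le> 2) \<longleftrightarrow>
        (\<forall>b. card {y. y + star (L y) u = b} \<le> 2 - of_bool (u \<in> {0, \<alpha>}))"
      by (simp only: of_bool_def) auto
    also have "\<dots> \<longleftrightarrow> card {y. y + star (L y) u = 0} \<le> 2 - of_bool (u \<in> {0, \<alpha>})"
      by (rule card_additive_fibres_le_iff, standard)
        (simp add: additive.add[OF L] additive.add[OF star] algebra_simps)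
    finally show "(\<forall>b. card {p \<in> ?H. p \<in> sloped_line star u b} \<le> 2) \<longleftrightarrow>
        card {y. y + star (L y) u = 0} + of_bool (u \<in> {0, \<alpha>}) \<le> 2"
      by auto
  qed
  finally show ?thesis .
qed

text \<open>Dual count, with points sorted by type. \<open>Infty\<close> lies on just the two
  vertical lines, \<open>Slope u\<close> on a fibre of \<open>M\<close>, and an affine point on a
  fibre of \<open>m + star x (M m)\<close> together with its vertical line if that was
  added.\<close>

lemma line_hyperoval_graph_iff:
  fixes M :: "'a \<Rightarrow> 'a" and star :: "'a \<Rightarrow> 'a \<Rightarrow> 'a"
  assumes M: "additive M" and star: "\<And>x. additive (star x)" and star_zero: "\<And>u. star 0 u = 0"
    and "\<alpha> \<noteq> 0"
  shows "line_hyperoval star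
      ({sloped_line star (M m) m | m. True} \<union> {vertical_line 0, vertical_line \<alpha>}) \<longleftrightarrow>
    card {m. M m = 0} \<le> 2 \<and>
    (\<forall>x. card {m. m + star x (M m) = 0} + of_bool (x \<in> {0, \<alpha>}) \<le> 2)"
proof -
  let ?l = "\<lambda>m. sloped_line star (M m) m"
  let ?\<L> = "{?l m | m. True} \<union> {vertical_line 0, vertical_line \<alpha>}"
  have mem: "Affine x y \<in> ?l m \<longleftrightarrow> m + star x (M m) = y" "Slope u \<in> ?l m \<longleftrightarrow> M m = u"
    "Infty \<notin> ?l m" for x y m u
    by (auto simp: sloped_line_def add.commute)
  have mem_vertical: "Affine x y \<in> vertical_line c \<longleftrightarrow> x = c" "Slope u \<notin> vertical_line c"
    "Infty \<in> vertical_line c" for x y c u :: 'a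
    by (auto simp: vertical_line_def)
  have inj: "inj_on ?l A" for A
  proof (rule inj_onI)
    fix m m' assume "?l m = ?l m'"
    \<comment> \<open>As \<open>star 0\<close> vanishes, the line crosses the vertical line over 0
      at height \<open>m\<close>, which recovers the parameter.\<close>
    moreover have "Affine 0 m \<in> ?l m" by (simp add: mem star_zero)
    ultimately have "Affine 0 m \<in> ?l m'" by simp
    then show "m = m'" by (simp add: mem star_zero)
  qed
  \<comment> \<open>The point \<open>Infty\<close> separates the two kinds of lines.\<close>
  have sloped_vertical: "?l m \<noteq> vertical_line c" for m c
    using mem(3) mem_vertical(3) by metis
  have vertical: "vertical_line (0::'a) \<noteq> vertical_line \<alpha>"
    using \<open>\<alpha> \<noteq> 0\<close> mem_vertical(1) by metis
  have \<L>: "?\<L> = range ?l \<union> {vertical_line 0, vertical_line \<alpha>}" by blast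
  have "card ?\<L> = CARD('a) + 2"
    unfolding \<L> using vertical sloped_vertical
    by (subst card_Un_disjoint) (auto simp: card_image[OF inj])
  moreover have "?\<L> \<subseteq> plane_lines star"
    by (auto simp: plane_lines_def)
  ultimately have "line_hyperoval star ?\<L> \<longleftrightarrow> (\<forall>P. card {l \<in> ?\<L>. P \<in> l} \<le> 2)"
    by (rule line_hyperoval_iff_card_le_two)
  also have "\<dots> \<longleftrightarrow> (\<forall>u. card {l \<in> ?\<L>. Slope u \<in> l} \<le> 2) \<and>
      (\<forall>x y. card {l \<in> ?\<L>. Affine x y \<in> l} \<le> 2)"
  proof -
    have "{l \<in> ?\<L>. Infty \<in> l} = {vertical_line 0, vertical_line \<alpha>}"
      by (auto simp: mem mem_vertical)
    then have "card {l \<in> ?\<L>. Infty \<in> l} \<le> 2"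
      by (simp only:) (simp add: card_insert_if)
    then show ?thesis
      unfolding all_point[of "\<lambda>P. card {l \<in> ?\<L>. P \<in> l} \<le> 2"] by blast
  qed
  also have "(\<forall>u. card {l \<in> ?\<L>. Slope u \<in> l} \<le> 2) \<longleftrightarrow> card {m. M m = 0} \<le> 2"
  proof -
    have "{l \<in> ?\<L>. Slope u \<in> l} = ?l ` {m. M m = u}" for u
      by (auto simp: mem mem_vertical)
    then show ?thesis
      by (simp only: card_image[OF inj] card_additive_fibres_le_iff[OF M])
  qed
  also have "(\<forall>x y. card {l \<in> ?\<L>. Affine x y \<in> l} \<le> 2) \<longleftrightarrow>
      (\<forall>x. card {m. m + star x (M m) = 0} + of_bool (x \<in> {0, \<alpha>}) \<le> 2)"
  proof (rule all_cong1)
    fix x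
    have "{l \<in> ?\<L>. Affine x y \<in> l}
        = ?l ` {m. m + star x (M m) = y} \<union> (if x \<in> {0, \<alpha>} then {vertical_line x} else {})" for y
      by (auto simp: mem mem_vertical)
    then have "card {l \<in> ?\<L>. Affine x y \<in> l}
        = card {m. m + star x (M m) = y} + of_bool (x \<in> {0, \<alpha>})" for y
      by (simp only:) (rule card_image_Un_if[OF inj sloped_vertical])
    then have "(\<forall>y. card {l \<in> ?\<L>. Affine x y \<in> l} \<le> 2) \<longleftrightarrow>
        (\<forall>y. card {m. m + star x (M m) = y} \<le> 2 - of_bool (x \<in> {0, \<alpha>}))"
      by (simp only: of_bool_def) auto
    also have "\<dots> \<longleftrightarrow> card {m. m + star x (M m) = 0} \<le> 2 - of_bool (x \<in> {0, \<alpha>})"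
      by (rule card_additive_fibres_le_iff, standard)
        (simp add: additive.add[OF M] additive.add[OF star] algebra_simps)
    finally show "(\<forall>y. card {l \<in> ?\<L>. Affine x y \<in> l} \<le> 2) \<longleftrightarrow>
        card {m. m + star x (M m) = 0} + of_bool (x \<in> {0, \<alpha>}) \<le> 2"
      by auto
  qed
  finally show ?thesis .
qed

lemma knuth_td_zero: "knuth_td_mult n 0 (u::'a) = 0"
  by (simp add: knuth_td_mult_def additive.zero[OF trace_additive])

end

theorem theorem3p3:
  fixes n :: nat and a :: "nat \<Rightarrow> 'a::{field,finite}" and \<alpha> :: 'a
  assumes "odd n" and "CARD('a) = 2 ^ n" and "\<alpha> \<noteq> 0"
  shows "hyperoval (knuth_mult n)
           ({Affine (poly (linearized_poly n a) y) y | y. True} \<union> {Slope 0, Slope \<alpha>})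
         \<longleftrightarrow>
         line_hyperoval (knuth_td_mult n)
           ({sloped_line (knuth_td_mult n) (poly (adjoint_poly n a) m) m | m. True}
              \<union> {vertical_line 0, vertical_line \<alpha>})"
proof -
  \<comment> \<open>Matches the condition from vertical lines with the dual one from points at
    infinity. The remaining conditions agree for each \<open>u\<close>, a slope in one plane and a
    first coordinate in the other.\<close>
  have "card {y. poly (linearized_poly n a) y = 0} = card {m. poly (adjoint_poly n a) m = 0}"
    by (rule card_kernel_adjoint[OF assms(2) trace_linearized_adjoint[OF assms(2)]])
  then show ?thesis
    unfolding hyperoval_graph_iff[OF assms(2) additive_linearized[OF assms(2)]
        additive_knuth_left[OF assms(2)] assms(3)]
      line_hyperoval_graph_iff[where star = "knuth_td_mult n", OF assms(2)
        additive_adjoint[OF assms(2)] additive_knuth_td_right[OF assms(2)]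
        knuth_td_zero[OF assms(2)] assms(3)]
      card_kernel_knuth[OF assms(2)] by (simp only:)
qed

end
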